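(* For $n\geq 1$, let $$Q_n^{(3)}(z) = \sum_{k=0}^{n-1}f_n(k)z^k.$$ Then $f_n(k)$ is the number of restricted colored base-$3$ partitions of $\frac{1}{2}(3^n-3)$ such that the number of single unmarked parts plus the number of pairs of unmarked parts equals $k$. Furthermore, for these partitions of $\frac{1}{2}(3^n-3)$: (a) there are $2^{n-1}$ partitions without unmarked parts; (b) the maximal sum of the number of single unmarked parts and the number of pairs of unmarked parts in a partition is $n-1$; (c) this maximum is achieved by $\frac{1}{2}(3^n-1)$ partitions.
   Context: Let $Z=(w,x,y,z)$ be a quadruple of variables. The polynomials $S(n;Z)$, $n\ge 0$, are defined by the generating function $$\sum_{n=0}^{\infty}S(n;Z)q^n = \prod_{j=0}^{\infty}\left(1+wq^{3^j}\right)\left(1+xq^{3^j}\right)\left(1+yq^{3^j}+zq^{2\cdot 3^j}\right).$$ Define $Q_n(Z):=S(\tfrac{3^n-3}{2};Z)$ for $n\geq 1$, and $Q_n^{(3)}(z):=Q_n(1,1,z,z)$. A restricted colored base-$3$ partition of an integer $m\geq 0$ is a way of writing $m$ as a sum of powers of $3$ (with $3^0=1$ allowed; the order of the summands is irrelevant), where each part is either overlined, marked by a tilde, or unmarked (no part carries both marks), such that for every power $3^j$: at most one copy of $3^j$ is overlined, at most one copy of $3^j$ is marked by a tilde, and at most two copies of $3^j$ are unmarked. The integer $0$ has exactly one such partition, the empty one. The number of single unmarked parts is the number of powers $3^j$ of which exactly one unmarked copy occurs; the number of pairs of unmarked parts is the number of powers $3^j$ of which exactly two unmarked copies occur. *)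

theory Defs
  imports "HOL-Analysis.Analysis" "HOL-Library.Multiset"
begin

section \<open>The polynomials \<open>S(n;Z)\<close> and \<open>Q\<^sub>n(Z)\<close>\<close>

text \<open>
  The polynomials in \<open>Z = (w,x,y,z)\<close> are given by their values at arbitrary elements of an
  arbitrary integral domain. This covers the formal polynomials themselves (take a
  polynomial ring and its variables) as well as all specializations of the variables.
\<close>

definition genfactor :: "'a::idom \<times> 'a \<times> 'a \<times> 'a \<Rightarrow> nat \<Rightarrow> 'a fps" where
  "genfactor Z j = (case Z of (w, x, y, z) \<Rightarrow>
     (1 + fps_const w * fps_X ^ (3 ^ j)) * (1 + fps_const x * fps_X ^ (3 ^ j)) *
     (1 + fps_const y * fps_X ^ (3 ^ j) + fps_const z * fps_X ^ (2 * 3 ^ j)))"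

definition S :: "nat \<Rightarrow> 'a::idom \<times> 'a \<times> 'a \<times> 'a \<Rightarrow> 'a" where
  "S n Z = fps_nth (\<Prod>j. genfactor Z j) n"

definition Q :: "nat \<Rightarrow> 'a::idom \<times> 'a \<times> 'a \<times> 'a \<Rightarrow> 'a" where
  "Q n Z = S ((3 ^ n - 3) div 2) Z"

definition Q3 :: "nat \<Rightarrow> int poly" where
  "Q3 n = (let z = [:0, 1:] in Q n (1, 1, z, z))"

text \<open>The infinite product converges in the topology of formal power series.\<close>

lemma genfactor_nth_0 [simp]: "fps_nth (genfactor Z j) 0 = 1"
  by (cases Z) (simp add: genfactor_def)

lemma genfactor_nth_eq_0:
  assumes "0 < k" "k < 3 ^ j"
  shows "fps_nth (genfactor Z j) k = 0"
proof -
  obtain w x y z where Z: "Z = (w, x, y, z)" by (cases Z)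
  let ?X = "fps_X :: 'a fps" and ?N = "3 ^ j :: nat"
  have eq: "(1 + a * u) * (1 + b * u) * (1 + c * u + d * (u * u)) =
      1 + u * (a + b + a * b * u + (1 + a * u) * (1 + b * u) * (c + d * u))"
    for a b c d u :: "'a fps"
    by (simp add: algebra_simps)
  have "genfactor Z j = 1 + ?X ^ ?N *
      (fps_const w + fps_const x + fps_const w * fps_const x * ?X ^ ?N
       + (1 + fps_const w * ?X ^ ?N) * (1 + fps_const x * ?X ^ ?N)
         * (fps_const y + fps_const z * ?X ^ ?N))"
    unfolding genfactor_def Z prod.case mult_2 power_add by (rule eq)
  also have "fps_nth \<dots> k = 0"
    using assms by (simp add: fps_X_power_mult_nth)
  finally show ?thesis .
qed

lemma mult_genfactor_nth:
  assumes "k < 3 ^ j"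
  shows "fps_nth (F * genfactor Z j) k = fps_nth F k"
proof -
  have "fps_nth (F * genfactor Z j) k = (\<Sum>i=0..k. fps_nth F i * fps_nth (genfactor Z j) (k - i))"
    by (simp add: fps_mult_nth)
  also have "\<dots> = (\<Sum>i=0..k. if i = k then fps_nth F i else 0)"
    using assms by (intro sum.cong) (auto intro!: genfactor_nth_eq_0)
  finally show ?thesis by simp
qed

lemma prod_genfactor_nth:
  assumes "k \<le> n"
  shows "fps_nth (\<Prod>j\<le>n. genfactor Z j) k = fps_nth (\<Prod>j\<le>k. genfactor Z j) k"
  using assms
proof (induction n rule: dec_induct)
  case (step n)
  have "n < 3 ^ n" by (rule less_exp[THEN order_less_le_trans]) (simp add: power_mono)
  also have "\<dots> \<le> 3 ^ Suc n" by simp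
  finally have "k < 3 ^ Suc n" using step.hyps by linarith
  thus ?case using step by (simp add: mult_genfactor_nth del: power_Suc)
qed simp

lemma genfactor_has_prod:
  "genfactor Z has_prod Abs_fps (\<lambda>k. fps_nth (\<Prod>j\<le>k. genfactor Z j) k)" (is "_ has_prod ?P")
proof -
  have "(\<lambda>n. \<Prod>j\<le>n. genfactor Z j) \<longlonglongrightarrow> ?P"
  proof (rule tendsto_fpsI)
    show "\<forall>\<^sub>F n in sequentially. fps_nth (\<Prod>j\<le>n. genfactor Z j) k = fps_nth ?P k" for k
      using eventually_ge_at_top[of k] by eventually_elim (unfold fps_nth_Abs_fps, rule prod_genfactor_nth)
  qed
  moreover have "?P \<noteq> 0"
  proof
    assume "?P = 0"
    hence "fps_nth ?P 0 = fps_nth 0 0" by (rule arg_cong)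
    thus False by simp
  qed
  ultimately show ?thesis
    unfolding has_prod_def raw_has_prod_def add_0_right by blast
qed

lemma S_altdef: "S n Z = fps_nth (\<Prod>j\<le>n. genfactor Z j) n"
  unfolding S_def has_prod_unique[OF genfactor_has_prod, symmetric] by (rule fps_nth_Abs_fps)


section \<open>Restricted colored base-3 partitions\<close>

datatype mark = Unmarked | Overlined | Tilde

text \<open>A part is a pair of its value (a power of 3, not the exponent) and its mark.\<close>

definition restricted_partitions :: "nat \<Rightarrow> (nat \<times> mark) multiset set" where
  "restricted_partitions m = {P.
     (\<forall>p \<in># P. \<exists>j. fst p = 3 ^ j) \<and>
     (\<forall>j. count P (3 ^ j, Overlined) \<le> 1 \<and>
          count P (3 ^ j, Tilde) \<le> 1 \<and>
          count P (3 ^ j, Unmarked) \<le> 2) \<and>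
     (\<Sum>p \<in># P. fst p) = m}"

definition single_unmarked :: "(nat \<times> mark) multiset \<Rightarrow> nat" where
  "single_unmarked P = card {j. count P (3 ^ j, Unmarked) = 1}"

definition pairs_unmarked :: "(nat \<times> mark) multiset \<Rightarrow> nat" where
  "pairs_unmarked P = card {j. count P (3 ^ j, Unmarked) = 2}"

lemma finite_unmarked_powers:
  assumes "c > 0"
  shows "finite {j. count P (3 ^ j :: nat, Unmarked) = c}"
proof (rule finite_imageD)
  show "finite ((\<lambda>j. (3 ^ j :: nat, Unmarked)) ` {j. count P (3 ^ j, Unmarked) = c})"
    by (rule finite_subset[of _ "set_mset P"]) (use assms in \<open>auto intro: count_inI\<close>)
qed (auto simp: inj_on_def)

lemma finite_restricted_partitions: "finite (restricted_partitions m)"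
proof -
  let ?L = "{xs. set xs \<subseteq> {..m} \<times> {Unmarked, Overlined, Tilde} \<and> length xs \<le> m}"
  have "restricted_partitions m \<subseteq> mset ` ?L"
  proof
    fix P assume P: "P \<in> restricted_partitions m"
    obtain xs where xs: "P = mset xs" using ex_mset by metis
    have pos: "1 \<le> fst p" if "p \<in># P" for p
      using P that by (fastforce simp: restricted_partitions_def)
    have sum: "(\<Sum>p \<in># P. fst p) = m" using P by (simp add: restricted_partitions_def)
    have "size P = (\<Sum>p \<in># P. 1)" by simp
    also have "\<dots> \<le> m" unfolding sum[symmetric] using pos by (rule sum_mset_mono)
    finally have "length xs \<le> m" using xs by simp
    moreover have "fst p \<le> m" if "p \<in># P" for p
      using that unfolding sum[symmetric] by (auto dest!: multi_member_split)
    moreover have "c \<in> {Unmarked, Overlined, Tilde}" for c by (cases c) auto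
    ultimately have "xs \<in> ?L" using xs by (auto simp: mem_Times_iff)
    thus "P \<in> mset ` ?L" using xs by blast
  qed
  moreover have "finite ?L" by (intro finite_lists_length_le) simp
  ultimately show ?thesis by (rule finite_subset[OF _ finite_imageI])
qed

end

theory Submission
  imports Defs "HOL-Computational_Algebra.Formal_Laurent_Series"
begin

text \<open>
  Choosing one monomial from each factor of the generating function amounts to choosing, for
  each power of 3, how many overlined, tilde-marked and unmarked copies of it to use. So \<open>S m Z\<close>
  is a weighted sum over the restricted partitions of \<open>m\<close> (\<open>S_eq_sum_restricted_partitions\<close>).
  At \<open>Z = (1, 1, z, z)\<close> each power of 3 with an unmarked copy contributes one factor \<open>z\<close>, whether
  it carries a single copy or a pair, and the coefficients of \<open>Q\<^sub>n\<^sup>(\<^sup>3\<^sup>)\<close> become the partition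
  counts (\<open>coeff_Q3\<close>).

  What remains is the degree, the constant term and the leading coefficient of \<open>Q\<^sub>n\<^sup>(\<^sup>3\<^sup>)\<close>. The
  generating function \<open>F\<close> satisfies \<open>F(q) = G(q) F(q\<^sup>3)\<close>, where \<open>G\<close> is its factor for \<open>j = 0\<close>, a
  polynomial of degree 4 in \<open>q\<close>; comparing coefficients gives \<open>S_recurrence\<close>. The indices
  \<open>e\<^sub>n = (3\<^sup>n - 3)/2\<close> satisfy \<open>e\<^sub>n\<^sub>+\<^sub>1 = 3 e\<^sub>n + 3\<close>, so the pair \<open>A\<^sub>n = S(e\<^sub>n)\<close>, \<open>B\<^sub>n = S(e\<^sub>n + 1)\<close>
  is closed under the recurrences: at \<open>Z = (1, 1, z, z)\<close> they read
  \<open>A\<^sub>n\<^sub>+\<^sub>1 = B\<^sub>n + 3 z A\<^sub>n\<close> and \<open>B\<^sub>n\<^sub>+\<^sub>1 = (2 + z) B\<^sub>n + z A\<^sub>n\<close>, starting from \<open>A\<^sub>1 = 1\<close> and \<open>B\<^sub>1 = 2 + z\<close>.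
  Setting \<open>z = 0\<close> gives powers of 2. By induction \<open>A\<^sub>n\<close> and \<open>B\<^sub>n\<close> have degree at most \<open>n - 1\<close> and
  \<open>n\<close>, the coefficient of \<open>z\<^sup>n\<close> in \<open>B\<^sub>n\<close> is 1, and the coefficient \<open>a\<^sub>n\<close> of \<open>z\<^sup>n\<^sup>-\<^sup>1\<close> in \<open>A\<^sub>n\<close>
  satisfies \<open>a\<^sub>n\<^sub>+\<^sub>1 = 1 + 3 a\<^sub>n\<close>, whence \<open>a\<^sub>n = (3\<^sup>n - 1)/2\<close> (\<open>Q3_coeffs\<close>).
\<close>

section \<open>Partitions as families of multiplicities\<close>

text \<open>The numbers of overlined, tilde-marked and unmarked copies of one fixed power of 3, in this order.\<close>

type_synonym mults = "nat \<times> nat \<times> nat"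

definition admissible :: "mults set" where
  "admissible = {0,1} \<times> {0,1} \<times> {0,1,2}"

lemma admissible_iff: "(a, b, c) \<in> admissible \<longleftrightarrow> a \<le> 1 \<and> b \<le> 1 \<and> c \<le> 2"
proof -
  have "a \<in> {0, 1} \<longleftrightarrow> a \<le> 1" "b \<in> {0, 1} \<longleftrightarrow> b \<le> 1" "c \<in> {0, 1, 2} \<longleftrightarrow> c \<le> 2"
    by (simp_all, linarith+)
  thus ?thesis unfolding admissible_def mem_Sigma_iff by simp
qed

fun copies :: "mults \<Rightarrow> nat" where
  "copies (a, b, c) = a + b + c"

fun mults_weight :: "'a::idom \<times> 'a \<times> 'a \<times> 'a \<Rightarrow> mults \<Rightarrow> 'a" where
  "mults_weight (w, x, y, z) (a, b, c) =
     w ^ a * x ^ b * (if c = 0 then 1 else if c = 1 then y else z)"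

definition mults_of :: "(nat \<times> mark) multiset \<Rightarrow> nat \<Rightarrow> mults" where
  "mults_of P j = (count P (3 ^ j, Overlined), count P (3 ^ j, Tilde), count P (3 ^ j, Unmarked))"

fun parts_at :: "nat \<Rightarrow> mults \<Rightarrow> (nat \<times> mark) multiset" where
  "parts_at j (a, b, c) = replicate_mset a (3 ^ j, Overlined) +
     replicate_mset b (3 ^ j, Tilde) + replicate_mset c (3 ^ j, Unmarked)"

definition parts_upto :: "nat \<Rightarrow> (nat \<Rightarrow> mults) \<Rightarrow> (nat \<times> mark) multiset" where
  "parts_upto N g = (\<Sum>j\<le>N. parts_at j (g j))"

lemma parts_upto_cong:
  "(\<And>j. j \<le> N \<Longrightarrow> g j = h j) \<Longrightarrow> parts_upto N g = parts_upto N h"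
  unfolding parts_upto_def by (intro sum.cong) auto

lemma sum_parts_at: "(\<Sum>p \<in># parts_at j d. fst p) = copies d * 3 ^ j"
  by (cases d) (simp add: add_mult_distrib)

lemma sum_parts_upto: "(\<Sum>p \<in># parts_upto N g. fst p) = (\<Sum>j\<le>N. copies (g j) * 3 ^ j)"
proof (induction N)
  case (Suc N)
  thus ?case by (simp only: parts_upto_def sum.atMost_Suc image_mset_union sum_mset.union sum_parts_at)
qed (simp add: parts_upto_def sum_parts_at)

lemma mults_of_parts_upto: "mults_of (parts_upto N g) i = (if i \<le> N then g i else (0, 0, 0))"
proof (induction N)
  case 0
  show ?case by (cases "g 0") (auto simp: parts_upto_def mults_of_def)
next
  case (Suc N)
  have "parts_upto (Suc N) g = parts_upto N g + parts_at (Suc N) (g (Suc N))"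
    by (simp add: parts_upto_def)
  with Suc show ?case
    by (cases "g (Suc N)") (auto simp: mults_of_def le_Suc_eq simp del: power_Suc)
qed

lemma part_upto_power: "p \<in># parts_upto N g \<Longrightarrow> \<exists>j. fst p = 3 ^ j"
proof -
  have "p \<in># parts_at j d \<Longrightarrow> fst p = 3 ^ j" for j d
    by (cases d) (auto split: if_splits)
  thus "p \<in># parts_upto N g \<Longrightarrow> \<exists>j. fst p = 3 ^ j"
    unfolding parts_upto_def set_mset_sum[OF finite_atMost] by blast
qed

text \<open>Since \<open>i < 3 ^ i\<close>, every exponent occurring in a partition of \<open>m\<close> is at most \<open>m\<close>. Families indexed by \<open>{..m}\<close> therefore describe the whole partition.\<close>

lemma restricted_part_le:
  assumes "P \<in> restricted_partitions m" "(v, c) \<in># P"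
  obtains i where "v = 3 ^ i" "i \<le> m"
proof -
  obtain i where i: "v = 3 ^ i" using assms by (force simp: restricted_partitions_def)
  have "v \<le> m" using assms by (auto simp: restricted_partitions_def dest!: multi_member_split)
  moreover have "i < 3 ^ i" by (rule less_exp[THEN order_less_le_trans]) (simp add: power_mono)
  ultimately show thesis using that i by simp
qed

lemma parts_upto_mults_of:
  assumes "P \<in> restricted_partitions m"
  shows "parts_upto m (mults_of P) = P"
proof (rule multiset_eqI)
  fix p :: "nat \<times> mark"
  obtain v c where p: "p = (v, c)" by (cases p)
  show "count (parts_upto m (mults_of P)) p = count P p"
    \<comment> \<open>The counts at powers of 3 are read off from \<open>mults_of\<close>; all other counts are zero on both sides.\<close>
  proof (cases "\<exists>i\<le>m. v = 3 ^ i")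
    case True
    then obtain i where i: "i \<le> m" "v = 3 ^ i" by auto
    have "mults_of (parts_upto m (mults_of P)) i = mults_of P i"
      using i by (simp add: mults_of_parts_upto)
    thus ?thesis unfolding p i by (cases c) (simp_all add: mults_of_def)
  next
    case False
    have "p \<notin># P" using False assms p by (blast elim: restricted_part_le)
    moreover have "p \<notin># parts_upto m (mults_of P)"
    proof
      assume *: "p \<in># parts_upto m (mults_of P)"
      then obtain i where i: "v = 3 ^ i" using part_upto_power p by fastforce
      with False have "mults_of (parts_upto m (mults_of P)) i = (0, 0, 0)"
        by (auto simp: mults_of_parts_upto)
      hence "count (parts_upto m (mults_of P)) p = 0"
        unfolding p i by (cases c) (simp_all add: mults_of_def)
      with * show False by (metis not_in_iff)
    qed
    ultimately show ?thesis by (simp add: not_in_iff)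
  qed
qed

lemma mults_of_admissible:
  assumes "P \<in> restricted_partitions m"
  shows "mults_of P j \<in> admissible"
  using assms by (simp add: mults_of_def admissible_iff restricted_partitions_def)

lemma parts_upto_restricted:
  assumes "\<And>j. j \<le> N \<Longrightarrow> g j \<in> admissible"
  shows "parts_upto N g \<in> restricted_partitions (\<Sum>j\<le>N. copies (g j) * 3 ^ j)"
proof -
  have "mults_of (parts_upto N g) j \<in> admissible" for j
    using assms by (auto simp: mults_of_parts_upto) (simp add: admissible_def)
  hence "count (parts_upto N g) (3 ^ j, Overlined) \<le> 1 \<and>
      count (parts_upto N g) (3 ^ j, Tilde) \<le> 1 \<and> count (parts_upto N g) (3 ^ j, Unmarked) \<le> 2" for j
    unfolding mults_of_def admissible_iff by blast
  thus ?thesis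
    using part_upto_power by (auto simp: restricted_partitions_def sum_parts_upto)
qed

text \<open>The right-hand side is the form in which partitions come out of expanding the product of the
  factors for \<open>j \<le> m\<close> by distributivity, where the choice functions range over an extensional \<open>\<Pi>\<^sub>E\<close>.\<close>

lemma restricted_partitions_bij:
  "bij_betw (\<lambda>P. \<lambda>j\<in>{..m}. mults_of P j) (restricted_partitions m)
     {g \<in> {..m} \<rightarrow>\<^sub>E admissible. (\<Sum>j\<le>m. copies (g j) * 3 ^ j) = m}"
proof (rule bij_betw_byWitness[where f' = "parts_upto m"])
  have inverse: "parts_upto m (restrict (mults_of P) {..m}) = P" if "P \<in> restricted_partitions m" for P
    using parts_upto_mults_of[OF that] by (subst parts_upto_cong[of m _ "mults_of P"]) auto
  thus "\<forall>P\<in>restricted_partitions m. parts_upto m (restrict (mults_of P) {..m}) = P" by blast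
  show "\<forall>g\<in>{g \<in> {..m} \<rightarrow>\<^sub>E admissible. (\<Sum>j\<le>m. copies (g j) * 3 ^ j) = m}.
      restrict (mults_of (parts_upto m g)) {..m} = g"
  proof
    fix g assume "g \<in> {g \<in> {..m} \<rightarrow>\<^sub>E admissible. (\<Sum>j\<le>m. copies (g j) * 3 ^ j) = m}"
    hence g: "g \<in> {..m} \<rightarrow>\<^sub>E admissible" by blast
    show "restrict (mults_of (parts_upto m g)) {..m} = g"
    proof
      fix j
      show "restrict (mults_of (parts_upto m g)) {..m} j = g j"
        by (cases "j \<le> m") (simp_all add: mults_of_parts_upto PiE_arb[OF g])
    qed
  qed
  show "(\<lambda>P. restrict (mults_of P) {..m}) ` restricted_partitions m
      \<subseteq> {g \<in> {..m} \<rightarrow>\<^sub>E admissible. (\<Sum>j\<le>m. copies (g j) * 3 ^ j) = m}"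
  proof (rule image_subsetI)
    fix P assume P: "P \<in> restricted_partitions m"
    have "(\<Sum>j\<le>m. copies (mults_of P j) * 3 ^ j) = m"
      using P unfolding sum_parts_upto[symmetric] parts_upto_mults_of[OF P]
      by (simp add: restricted_partitions_def)
    thus "restrict (mults_of P) {..m} \<in>
        {g \<in> {..m} \<rightarrow>\<^sub>E admissible. (\<Sum>j\<le>m. copies (g j) * 3 ^ j) = m}"
      using mults_of_admissible[OF P] by simp
  qed
  show "parts_upto m ` {g \<in> {..m} \<rightarrow>\<^sub>E admissible. (\<Sum>j\<le>m. copies (g j) * 3 ^ j) = m}
      \<subseteq> restricted_partitions m"
  proof (rule image_subsetI)
    fix g assume "g \<in> {g \<in> {..m} \<rightarrow>\<^sub>E admissible. (\<Sum>j\<le>m. copies (g j) * 3 ^ j) = m}"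
    hence g: "g \<in> {..m} \<rightarrow>\<^sub>E admissible" and eq: "(\<Sum>j\<le>m. copies (g j) * 3 ^ j) = m"
      by blast+
    have "\<And>j. j \<le> m \<Longrightarrow> g j \<in> admissible" using PiE_mem[OF g] by simp
    from parts_upto_restricted[of m g, OF this] show "parts_upto m g \<in> restricted_partitions m"
      unfolding eq .
  qed
qed


section \<open>The generating function as a sum over partitions\<close>

text \<open>One factor of the generating function, multiplied out but with like powers of \<open>u\<close> not collected:
  the twelve summands correspond to the twelve admissible triples.\<close>

lemma sum_mults_weight:
  "(\<Sum>d\<in>admissible. mults_weight (w, x, y, z) d * u ^ copies d) =
     (1 + w * u) * (1 + x * u) * (1 + y * u + z * u ^ 2)"
  unfolding admissible_def sum.cartesian_product'[symmetric]
  by simp algebra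

lemma fps_const_mults_weight:
  "fps_const (mults_weight (w, x, y, z) d) =
     mults_weight (fps_const w, fps_const x, fps_const y, fps_const z) d"
  by (cases d) (simp flip: fps_const_mult fps_const_power)

lemma genfactor_expand:
  "genfactor Z j = (\<Sum>d\<in>admissible. fps_const (mults_weight Z d) * fps_X ^ (copies d * 3 ^ j))"
proof -
  obtain w x y z where Z: "Z = (w, x, y, z)" by (cases Z)
  show ?thesis
    unfolding Z fps_const_mults_weight mult.commute[of "copies _"] power_mult sum_mults_weight
    by (simp add: genfactor_def mult.commute[of 2] power_mult)
qed

lemma prod_genfactor_expand:
  fixes Z :: "'a::idom \<times> 'a \<times> 'a \<times> 'a"
  shows "(\<Prod>j\<le>N. genfactor Z j) = (\<Sum>g\<in>{..N} \<rightarrow>\<^sub>E admissible.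
     fps_const (\<Prod>j\<le>N. mults_weight Z (g j)) * fps_X ^ (\<Sum>j\<le>N. copies (g j) * 3 ^ j))"
proof -
  have "finite admissible" by (simp add: admissible_def)
  hence "(\<Prod>j\<le>N. genfactor Z j) = (\<Sum>g\<in>{..N} \<rightarrow>\<^sub>E admissible. \<Prod>j\<le>N.
     fps_const (mults_weight Z (g j)) * fps_X ^ (copies (g j) * 3 ^ j))"
    unfolding genfactor_expand by (subst prod_sum_PiE) auto
  moreover have "fps_const (\<Prod>j\<le>N. h j) = (\<Prod>j\<le>N. fps_const (h j))" for h :: "nat \<Rightarrow> 'a"
    by (induction N) (simp_all flip: fps_const_mult)
  ultimately show ?thesis by (simp add: prod.distrib power_sum)
qed

text \<open>The factors with \<open>j > m\<close> do not affect the coefficient of \<open>q\<^sup>m\<close>, so this is the finite expansion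
  restricted to the choice functions of total value \<open>m\<close> and reindexed by partitions.\<close>

lemma S_eq_sum_restricted_partitions:
  "S m Z = (\<Sum>P\<in>restricted_partitions m. \<Prod>j\<le>m. mults_weight Z (mults_of P j))"
proof -
  let ?G = "{..m} \<rightarrow>\<^sub>E admissible" and ?val = "\<lambda>g. \<Sum>j\<le>m. copies (g j) * 3 ^ j"
  have fin: "finite ?G" by (intro finite_PiE) (auto simp: admissible_def)
  have "S m Z = (\<Sum>g\<in>?G. if ?val g = m then \<Prod>j\<le>m. mults_weight Z (g j) else 0)"
    unfolding S_altdef prod_genfactor_expand fps_sum_nth
    by (intro sum.cong) (auto simp: fps_X_power_mult_right_nth)
  also have "\<dots> = (\<Sum>g\<in>{g \<in> ?G. ?val g = m}. \<Prod>j\<le>m. mults_weight Z (g j))"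
    using fin by (simp add: sum.inter_filter)
  also have "\<dots> = (\<Sum>P\<in>restricted_partitions m. \<Prod>j\<le>m.
      mults_weight Z (restrict (mults_of P) {..m} j))"
    by (rule sum.reindex_bij_betw[OF restricted_partitions_bij, symmetric])
  finally show ?thesis by simp
qed

lemma unmarked_exponents_subset:
  assumes "P \<in> restricted_partitions m"
  shows "{j. (3 ^ j, Unmarked) \<in># P} \<subseteq> {..m}"
proof
  fix j assume "j \<in> {j. (3 ^ j, Unmarked) \<in># P}"
  hence "(3 ^ j, Unmarked) \<in># P" by simp
  with assms show "j \<in> {..m}" by (rule restricted_part_le) simp
qed

text \<open>At most two unmarked copies of a power are allowed, so each power with an unmarked copy is
  counted exactly once, as a single part or as a pair.\<close>

lemma single_plus_pairs_unmarked:
  assumes "P \<in> restricted_partitions m"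
  shows "single_unmarked P + pairs_unmarked P = card {j. (3 ^ j, Unmarked) \<in># P}"
proof -
  have "count P (3 ^ j, Unmarked) \<le> 2" for j
    using assms by (simp add: restricted_partitions_def)
  moreover have "c \<noteq> 0 \<longleftrightarrow> c = 1 \<or> c = 2" if "c \<le> 2" for c :: nat
    using that by auto
  moreover have "(3 ^ j, Unmarked) \<in># P \<longleftrightarrow> count P (3 ^ j, Unmarked) \<noteq> 0" for j
    by (simp add: not_in_iff)
  ultimately have "{j. (3 ^ j, Unmarked) \<in># P} =
      {j. count P (3 ^ j, Unmarked) = 1} \<union> {j. count P (3 ^ j, Unmarked) = 2}"
    by blast
  thus ?thesis
    unfolding single_unmarked_def pairs_unmarked_def
    by (subst card_Un_disjoint[symmetric]) (auto simp: finite_unmarked_powers)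
qed

lemma single_plus_pairs_unmarked_eq_0_iff:
  assumes "P \<in> restricted_partitions m"
  shows "single_unmarked P + pairs_unmarked P = 0 \<longleftrightarrow> (\<forall>p \<in># P. snd p \<noteq> Unmarked)"
proof -
  have "finite {j. (3 ^ j, Unmarked) \<in># P}"
    using unmarked_exponents_subset[OF assms] by (rule finite_subset) simp
  hence "single_unmarked P + pairs_unmarked P = 0 \<longleftrightarrow> (\<forall>j. (3 ^ j, Unmarked) \<notin># P)"
    unfolding single_plus_pairs_unmarked[OF assms] by simp
  also have "\<dots> \<longleftrightarrow> (\<forall>p \<in># P. snd p \<noteq> Unmarked)"
    using restricted_part_le[OF assms] by (metis prod.collapse snd_conv)
  finally show ?thesis .
qed

lemma prod_mults_weight_unmarked:
  assumes "P \<in> restricted_partitions m"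
  shows "(\<Prod>j\<le>m. mults_weight (1, 1, z, z) (mults_of P j)) =
     z ^ (single_unmarked P + pairs_unmarked P)"
proof -
  let ?J = "{j. (3 ^ j, Unmarked) \<in># P}"
  have J: "?J \<subseteq> {..m}"
    using assms by (rule unmarked_exponents_subset)
  have "(\<Prod>j\<le>m. mults_weight (1, 1, z, z) (mults_of P j)) = (\<Prod>j\<le>m. if j \<in> ?J then z else 1)"
    by (intro prod.cong refl) (simp add: mults_of_def count_eq_zero_iff)
  also have "\<dots> = (\<Prod>j\<in>{..m} \<inter> ?J. z)" by (subst prod.inter_restrict) auto
  also have "\<dots> = z ^ card ?J" using J by (simp add: Int_absorb1)
  finally show ?thesis using single_plus_pairs_unmarked[OF assms] by simp
qed

lemma coeff_Q3:
  "poly.coeff (Q3 n) k = int (card {P \<in> restricted_partitions ((3 ^ n - 3) div 2).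
     single_unmarked P + pairs_unmarked P = k})" (is "_ = int (card {P \<in> ?R. ?s P = k})")
proof -
  have "Q3 n = (\<Sum>P\<in>?R. monom 1 (?s P))"
    unfolding Q3_def Let_def Q_def S_eq_sum_restricted_partitions
    by (intro sum.cong) (simp_all add: prod_mults_weight_unmarked monom_altdef)
  hence "poly.coeff (Q3 n) k = (\<Sum>P\<in>?R. if ?s P = k then 1 else 0)"
    by (simp add: coeff_sum)
  also have "\<dots> = int (card {P \<in> ?R. ?s P = k})"
    using finite_restricted_partitions by (simp flip: sum.inter_filter)
  finally show ?thesis .
qed


section \<open>Recurrences for the polynomials\<close>

text \<open>This is the source of the functional equation \<open>F(q) = G(q) F(q\<^sup>3)\<close>, here for finite products.\<close>

lemma genfactor_Suc:
  fixes Z :: "'a::idom \<times> 'a \<times> 'a \<times> 'a"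
  shows "genfactor Z (Suc j) = genfactor Z j oo fps_X ^ 3"
proof -
  have X: "fps_X ^ k oo fps_X ^ 3 = (fps_X ^ (3 * k) :: 'a fps)" for k
    by (simp add: power_mult flip: fps_compose_power)
  show ?thesis
    by (cases Z) (simp add: genfactor_def fps_compose_mult_distrib fps_compose_add_distrib X mult.left_commute)
qed

lemma prod_genfactor_Suc:
  "(\<Prod>j\<le>Suc N. genfactor Z j) = ((\<Prod>j\<le>N. genfactor Z j) oo fps_X ^ 3) * genfactor Z 0"
  unfolding prod.atMost_Suc_shift by (simp add: genfactor_Suc fps_compose_prod_distrib mult.commute)

text \<open>The coefficients on the right are those of \<open>q\<^sup>0, \<dots>, q\<^sup>4\<close> in \<open>(1 + wq)(1 + xq)(1 + yq + zq\<^sup>2)\<close>.\<close>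

lemma mult_genfactor_0_nth:
  "fps_nth (F * genfactor (w, x, y, z) 0) n = fps_nth F n
     + (w + x + y) * (if n < 1 then 0 else fps_nth F (n - 1))
     + (w * x + (w + x) * y + z) * (if n < 2 then 0 else fps_nth F (n - 2))
     + (w * x * y + (w + x) * z) * (if n < 3 then 0 else fps_nth F (n - 3))
     + w * x * z * (if n < 4 then 0 else fps_nth F (n - 4))"
proof -
  have ring: "F * ((1 + a * u) * (1 + b * u) * (1 + c * u + d * u ^ 2)) = F + (a + b + c) * (F * u ^ 1)
     + (a * b + (a + b) * c + d) * (F * u ^ 2) + (a * b * c + (a + b) * d) * (F * u ^ 3)
     + a * b * d * (F * u ^ 4)" for a b c d u :: "'a fps"
    by algebra
  have "F * genfactor (w, x, y, z) 0 = F + fps_const (w + x + y) * (F * fps_X ^ 1)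
     + fps_const (w * x + (w + x) * y + z) * (F * fps_X ^ 2)
     + fps_const (w * x * y + (w + x) * z) * (F * fps_X ^ 3)
     + fps_const (w * x * z) * (F * fps_X ^ 4)"
    using ring[of "fps_const w" fps_X "fps_const x" "fps_const y" "fps_const z"]
    by (simp add: genfactor_def)
  thus ?thesis
    by (simp only: fps_add_nth fps_mult_left_const_nth fps_X_power_mult_right_nth)
qed

text \<open>The series \<open>F(q\<^sup>3)\<close> has only exponents divisible by 3. Among the last five exponents up to \<open>3 n + 3\<close> or
  \<open>3 n + 4\<close> these are just \<open>3 n + 3\<close> and \<open>3 n\<close>.\<close>

lemma S_recurrence:
  "S (3 * n + 3) (w, x, y, z) = S (n + 1) (w, x, y, z) + (w * x * y + (w + x) * z) * S n (w, x, y, z)"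
  "S (3 * n + 4) (w, x, y, z) = (w + x + y) * S (n + 1) (w, x, y, z) + w * x * z * S n (w, x, y, z)"
proof -
  let ?Z = "(w, x, y, z)"
  \<comment> \<open>The bound \<open>3 n + 4\<close> makes the product long enough for every coefficient that is used.\<close>
  define F where "F = (\<Prod>j\<le>3*n+4. genfactor ?Z j) oo fps_X ^ 3"
  have F: "fps_nth F k = (if 3 dvd k then S (k div 3) ?Z else 0)" if "k \<le> 3 * n + 4" for k
    using that unfolding F_def fps_nth_compose_X_power S_altdef
    by (auto intro!: prod_genfactor_nth div_le_dividend[THEN order_trans])
  have S: "S k ?Z = fps_nth (F * genfactor ?Z 0) k" if "k \<le> 3 * n + 4" for k
    unfolding F_def prod_genfactor_Suc[symmetric] S_altdef
    by (rule prod_genfactor_nth[symmetric]) (use that in simp)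
  have F_0: "fps_nth F k = 0" if "k \<le> 3 * n + 4" "\<not> 3 dvd k" for k
    using that by (simp add: F)
  have "fps_nth F (3 * n + 4) = 0" "fps_nth F (3 * n + 2) = 0" "fps_nth F (3 * n + 1) = 0"
    by (rule F_0; presburger)+
  \<comment> \<open>For \<open>n = 0\<close> there is no such exponent, and \<open>3 * n - 1\<close> would be truncated to 0.\<close>
  moreover have "fps_nth F (3 * n - 1) = 0" if "n \<noteq> 0"
    using that by (intro F_0; presburger)
  moreover have "fps_nth F (3 * n + 3) = S (n + 1) ?Z" "fps_nth F (3 * n) = S n ?Z"
    by (simp_all add: F)
  ultimately show "S (3 * n + 3) ?Z = S (n + 1) ?Z + (w * x * y + (w + x) * z) * S n ?Z"
    "S (3 * n + 4) ?Z = (w + x + y) * S (n + 1) ?Z + w * x * z * S n ?Z"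
    using S[of "3 * n + 3"] S[of "3 * n + 4"]
      mult_genfactor_0_nth[of F w x y z "3 * n + 3"] mult_genfactor_0_nth[of F w x y z "3 * n + 4"]
    by (auto simp: add.commute split: if_splits)
qed

lemma S_0: "S 0 Z = 1"
  by (simp add: S_altdef)

lemma S_1: "S 1 (w, x, y, z) = w + x + y"
proof -
  have "S 1 (w, x, y, z) = fps_nth (genfactor (w, x, y, z) 0 * genfactor (w, x, y, z) 1) 1"
    by (simp add: S_altdef)
  also have "\<dots> = fps_nth (1 * genfactor (w, x, y, z) 0) 1"
    by (subst mult_genfactor_nth) simp_all
  also have "\<dots> = w + x + y"
    by (subst mult_genfactor_0_nth) simp
  finally show ?thesis .
qed

lemma Q_index_Suc: "(3 ^ Suc (Suc n) - 3) div 2 = 3 * ((3 ^ Suc n - 3) div 2) + (3 :: nat)"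
proof -
  have "odd (3 ^ n :: nat)" by simp
  then obtain k where "3 ^ n = 2 * k + (1 :: nat)" by (rule oddE)
  thus ?thesis by simp
qed

text \<open>The companion \<open>B\<close> at the next index is carried along because the recurrences couple the two
  sequences. The leading coefficient is stated without division so that the step
  \<open>a \<mapsto> 1 + 3 a\<close> is linear: \<open>2 (1 + 3 a) + 1 = 3 (2 a + 1)\<close>.\<close>

lemma Q3_coeffs:
  defines "X \<equiv> [:0, 1:] :: int poly"
  defines "B \<equiv> \<lambda>n. S ((3 ^ n - 3) div 2 + 1) (1, 1, X, X)"
  shows "degree (Q3 (Suc n)) \<le> n \<and> poly.coeff (Q3 (Suc n)) 0 = 2 ^ n \<and>
    2 * poly.coeff (Q3 (Suc n)) n + 1 = 3 ^ Suc n \<and>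
    degree (B (Suc n)) \<le> Suc n \<and> poly.coeff (B (Suc n)) 0 = 2 ^ Suc n \<and>
    poly.coeff (B (Suc n)) (Suc n) = 1"
proof (induction n)
  case 0
  have "Q3 (Suc 0) = 1" by (simp add: Q3_def Q_def S_0)
  moreover have "B (Suc 0) = [:2, 1:]"
    unfolding B_def by (simp add: S_1[unfolded One_nat_def] X_def one_pCons)
  ultimately show ?case by simp
next
  case (Suc n)
  define m :: nat where "m = (3 ^ Suc n - 3) div 2"
  have Q3: "Q3 k = S ((3 ^ k - 3) div 2) (1, 1, X, X)" for k
    by (simp add: Q3_def Q_def X_def Let_def)
  have coeffs: "1 * 1 * X + (1 + 1) * X = [:0, 3:]" "1 + 1 + X = [:2, 1:]" "1 * 1 * X = [:0, 1:]"
    by (simp_all add: X_def one_pCons numeral_poly)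
  have A: "Q3 (Suc (Suc n)) = B (Suc n) + pCons 0 (smult 3 (Q3 (Suc n)))"
    unfolding Q3 Q_index_Suc B_def S_recurrence coeffs(1) by simp
  have B: "B (Suc (Suc n)) = smult 2 (B (Suc n)) + pCons 0 (B (Suc n) + Q3 (Suc n))"
    unfolding Q3 B_def Q_index_Suc using S_recurrence(2)[of m 1 1 X X, unfolded coeffs]
    by (simp add: m_def smult_add_right add.commute add.left_commute)
  have deg: "degree (Q3 (Suc n)) \<le> n" "degree (B (Suc n)) \<le> Suc n" using Suc by auto
  hence 0: "poly.coeff (Q3 (Suc n)) (Suc n) = 0" "poly.coeff (B (Suc n)) (Suc (Suc n)) = 0"
    by (auto intro!: coeff_eq_0)
  have "degree (Q3 (Suc (Suc n))) \<le> Suc n"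
    unfolding A using deg by (intro degree_add_le) (auto intro: order_trans[OF degree_pCons_le])
  moreover have "degree (B (Suc (Suc n))) \<le> Suc (Suc n)"
    unfolding B using deg
    by (intro degree_add_le order_trans[OF degree_pCons_le] Suc_le_mono[THEN iffD2]) auto
  moreover have "poly.coeff (Q3 (Suc (Suc n))) 0 = 2 ^ Suc n"
    "2 * poly.coeff (Q3 (Suc (Suc n))) (Suc n) + 1 = 3 ^ Suc (Suc n)"
    using Suc by (simp_all add: A)
  moreover have "poly.coeff (B (Suc (Suc n))) 0 = 2 ^ Suc (Suc n)"
    "poly.coeff (B (Suc (Suc n))) (Suc (Suc n)) = 1"
    using Suc 0 by (simp_all add: B)
  ultimately show ?case by blast
qed

theorem proposition5p5:
  fixes n :: nat and f :: "nat \<Rightarrow> int" and \<P> :: "(nat \<times> mark) multiset set"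
  assumes "n \<ge> 1"
  defines "f \<equiv> \<lambda>k. poly.coeff (Q3 n) k"
    and "\<P> \<equiv> restricted_partitions ((3 ^ n - 3) div 2)"
  shows "Q3 n = (\<Sum>k=0..n-1. monom (f k) k) \<and>
    (\<forall>k\<in>{0..n-1}. f k = int (card {P \<in> \<P>. single_unmarked P + pairs_unmarked P = k})) \<and>
    card {P \<in> \<P>. \<forall>p \<in># P. snd p \<noteq> Unmarked} = 2 ^ (n - 1) \<and>
    Max ((\<lambda>P. single_unmarked P + pairs_unmarked P) ` \<P>) = n - 1 \<and>
    card {P \<in> \<P>. single_unmarked P + pairs_unmarked P = n - 1} = (3 ^ n - 1) div 2"
proof (intro conjI ballI)
  let ?s = "\<lambda>P. single_unmarked P + pairs_unmarked P"
  have fin: "finite \<P>" by (simp add: \<P>_def finite_restricted_partitions)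
  have f: "f k = int (card {P \<in> \<P>. ?s P = k})" for k
    by (simp add: f_def \<P>_def coeff_Q3)
  thus "f k = int (card {P \<in> \<P>. ?s P = k})" for k .
  have deg: "degree (Q3 n) \<le> n - 1" and f_0: "f 0 = 2 ^ (n - 1)" and top: "2 * f (n - 1) + 1 = 3 ^ n"
    using Q3_coeffs[of "n - 1"] \<open>n \<ge> 1\<close> by (simp_all add: f_def)
  show "Q3 n = (\<Sum>k=0..n-1. monom (f k) k)"
    using poly_as_sum_of_monoms'[OF deg] by (simp add: f_def atLeast0AtMost)
  have "{P \<in> \<P>. \<forall>p \<in># P. snd p \<noteq> Unmarked} = {P \<in> \<P>. ?s P = 0}"
    unfolding \<P>_def by (rule Collect_cong) (use single_plus_pairs_unmarked_eq_0_iff in auto)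
  moreover have "int (card {P \<in> \<P>. ?s P = 0}) = int (2 ^ (n - 1))"
    using f_0 f[of 0] by simp
  ultimately show "card {P \<in> \<P>. \<forall>p \<in># P. snd p \<noteq> Unmarked} = 2 ^ (n - 1)"
    by (simp only: of_nat_eq_iff)
  have "int (2 * card {P \<in> \<P>. ?s P = n - 1} + 1) = int (3 ^ n)"
    using top f[of "n - 1"] by simp
  hence top_card: "2 * card {P \<in> \<P>. ?s P = n - 1} + 1 = 3 ^ n"
    by (simp only: of_nat_eq_iff)
  thus "card {P \<in> \<P>. ?s P = n - 1} = (3 ^ n - 1) div 2"
    by linarith
  have "1 < (3 :: nat) ^ n" using \<open>n \<ge> 1\<close> by (intro one_less_power) auto
  with top_card have "card {P \<in> \<P>. ?s P = n - 1} \<noteq> 0" by linarith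
  hence ex: "\<exists>P\<in>\<P>. ?s P = n - 1" using fin by (auto simp: card_eq_0_iff)
  \<comment> \<open>A partition with a larger statistic would make a coefficient beyond the degree positive.\<close>
  have le: "?s P \<le> n - 1" if "P \<in> \<P>" for P
  proof (rule ccontr)
    assume "\<not> ?s P \<le> n - 1"
    hence "f (?s P) = 0" using deg unfolding f_def by (intro coeff_eq_0) simp
    hence "{P' \<in> \<P>. ?s P' = ?s P} = {}" using fin f by simp
    with that show False by blast
  qed
  show "Max (?s ` \<P>) = n - 1"
  proof (rule Max_eqI)
    show "n - 1 \<in> ?s ` \<P>" using ex by force
  qed (use fin le in auto)
qed

end
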